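(* Let $w\in A_\infty$ on $\mathbb{R}^n$ and $1\le p<\infty$. Then there are constants $C>0$ and $\beta\in(0,1)$, depending only on the $A_\infty$ constant of $w$, on $p$ and on $n$, such that for all cubes $Q$ (with sidelength $R$) and all $u\in C^1(\mathbb{R}^n)$, $$\int_Q |\nabla u|^p+w|u|^p\ \ge\ \frac{C\,m_\beta\big(R^p\,\mathrm{av}_Q w\big)}{R^p}\int_Q|u|^p,$$ where $m_\beta(x)=x$ for $x\le1$ and $m_\beta(x)=x^\beta$ for $x\ge1$.
   Context: $\mathrm{av}_E v=\frac1{|E|}\int_E v$. $A_\infty=\bigcup_{q>1}B_q$, where for $1<q\le\infty$, $w\in B_q$ means: $w\in L^q_{loc}(\mathbb{R}^n)$, $w>0$ almost everywhere, and there is a constant $C$ such that for every cube $Q$, $\big(\frac1{|Q|}\int_Q w^q\big)^{1/q}\le \frac{C}{|Q|}\int_Q w$ (essential supremum on the left if $q=\infty$). Dependence on "the $A_\infty$ constant" means dependence on the quantitative constants in the $A_\infty$ condition (e.g. on a $q$ with $w\in B_q$ and its $B_q$ constant), and not on $Q$ or $u$. *)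

theory Defs
  imports "HOL-Analysis.Analysis" "HOL-Probability.Essential_Supremum"
begin

text \<open>Closed cubes with sides parallel to the axes, given by the lower corner and the sidelength.\<close>

definition cube :: "real^'n \<Rightarrow> real \<Rightarrow> (real^'n) set" where
  "cube a R = cbox a (\<chi> i. a $ i + R)"

definition av :: "(real^'n) set \<Rightarrow> (real^'n \<Rightarrow> real) \<Rightarrow> real" where
  "av E f = (LINT x:E|lebesgue. f x) / measure lebesgue E"

definition L_loc :: "ereal \<Rightarrow> (real^'n \<Rightarrow> real) set" where
  "L_loc q = {w. w \<in> borel_measurable lebesgue \<and>
     (\<forall>K. compact K \<longrightarrow>
       (if q = \<infinity>
        then esssup (restrict_space lebesgue K) (\<lambda>x. ereal \<bar>w x\<bar>) < \<infinity>
        else set_integrable lebesgue K (\<lambda>x. \<bar>w x\<bar> powr real_of_ereal q)))}"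

text \<open>Membership in the class \<open>B_q\<close> with the explicit constant \<open>K\<close> in the
  reverse Hoelder inequality; it is meant for \<open>1 < q \<le> \<infinity>\<close>.\<close>

definition B_with_const :: "ereal \<Rightarrow> real \<Rightarrow> (real^'n \<Rightarrow> real) set" where
  "B_with_const q K = {w. w \<in> L_loc q \<and> (AE x in lebesgue. 0 < w x) \<and>
     (\<forall>a R. 0 < R \<longrightarrow>
       (if q = \<infinity>
        then esssup (restrict_space lebesgue (cube a R)) (\<lambda>x. ereal (w x))
               \<le> ereal (K * av (cube a R) w)
        else (av (cube a R) (\<lambda>x. w x powr real_of_ereal q)) powr (1 / real_of_ereal q)
               \<le> K * av (cube a R) w))}"

definition B_class :: "ereal \<Rightarrow> (real^'n \<Rightarrow> real) set" where
  "B_class q = (\<Union>K. B_with_const q K)"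

definition A_infty :: "(real^'n \<Rightarrow> real) set" where
  "A_infty = (\<Union>q\<in>{1<..}. B_class q)"

text \<open>The gradient of a complex-valued function is the vector of its partial derivatives; the norm
  of \<open>complex^'n\<close> is the Euclidean (Hermitian) one. Real-valued functions are the special
  case of values in the reals.\<close>

definition grad :: "(real^'n \<Rightarrow> complex) \<Rightarrow> real^'n \<Rightarrow> complex^'n" where
  "grad u x = (\<chi> i. frechet_derivative u (at x) (axis i 1))"

definition C1 :: "(real^'n \<Rightarrow> complex) set" where
  "C1 = {u. (\<forall>x. u differentiable (at x)) \<and> continuous_on UNIV (grad u)}"

definition m_fun :: "real \<Rightarrow> real \<Rightarrow> real" where
  "m_fun \<beta> x = (if x \<le> 1 then x else x powr \<beta>)"

end

theory Submission
  imports Defs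
begin

text \<open>
  Why it is true. Write \<open>F(Q)\<close> for the integral of \<open>|grad u|^p + w |u|^p\<close> over a cube \<open>Q\<close> of
  side \<open>R\<close>, \<open>U(Q)\<close> for the integral of \<open>|u|^p\<close> and \<open>m\<close> for the mean of \<open>w\<close> over \<open>Q\<close>.

  The weight enters through the property recorded in \<open>A_infty_cond\<close>: there is a fixed
  \<open>\<eta> > 0\<close> such that a subset of \<open>Q\<close> of measure at most \<open>\<eta> |Q|\<close> carries at most half of the
  weight of \<open>Q\<close>. The reverse Hoelder inequality gives it through Jensen's inequality on the subset
  (\<open>B_with_const_imp_A_infty_cond\<close>), with \<open>\<eta>\<close> depending on \<open>q\<close> and \<open>K\<close> alone. It has two
  consequences.

  \<^item> The set where \<open>w > m / 4\<close> fills at least the proportion \<open>\<eta>\<close> of \<open>Q\<close>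
    (\<open>A_infty_cond_large_set\<close>). On that set compare \<open>u(y)\<close> with \<open>u(x)\<close>: the size of \<open>u(x)\<close> is paid
    for by the term \<open>w |u|^p\<close>, the difference by the gradient, through a Poincare inequality for
    pairs of points (\<open>poincare_double_integral\<close>). This yields
    \<open>F(Q) \<ge> c min(R^{-p}, m) U(Q)\<close> (\<open>fefferman_phong_one_scale\<close>), which is the claim when
    \<open>R^p m \<le> 1\<close>.

  \<^item> Halving the side of a cube lowers the mean by at most a fixed factor: each of the \<open>2^n\<close>
    dyadic children has mean at least \<open>d m\<close> (\<open>A_infty_cond_doubling\<close>).

  When \<open>R^p m\<close> is large, the minimum above is \<open>R^{-p}\<close> and information about \<open>m\<close> is lost, so \<open>Q\<close> is
  cut into cubes of side \<open>R / 2^k\<close>. By doubling their means are at least \<open>d^k m\<close>, and summing the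
  inequality over them gives \<open>F(Q) \<ge> c R^{-p} min(2^{kp}, d^k R^p m) U(Q)\<close> for every \<open>k\<close>
  (\<open>fefferman_phong_dyadic_scale\<close>). The two entries balance when \<open>(2^p / d)^k\<close> is about \<open>R^p m\<close>;
  there \<open>2^{kp}\<close> is about \<open>(R^p m)^\<beta>\<close> with \<open>(2^p / d)^\<beta> = 2^p\<close> (\<open>m_fun_le_some_scale\<close>).
\<close>

section \<open>Set integrals and convexity of powers\<close>

text \<open>
  The tangent at \<open>c\<close> supports a convex function. The value \<open>c = 0\<close> is included, where the left side
  vanishes even for \<open>p = 1\<close> because \<open>0 powr 0 = 0\<close>.
\<close>

lemma powr_ge_tangent:
  fixes c x p :: real
  assumes "1 \<le> p" "0 \<le> c" "0 \<le> x"
  shows "c powr p + p * c powr (p - 1) * (x - c) \<le> x powr p"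
proof (cases "c = 0")
  case False
  have "x powr p - c powr p \<ge> (p * c powr (p - 1)) * (x - c)"
  \<comment> \<open>The tangent criterion is applied on the open half-line; at \<open>x = 0\<close> the claim reads \<open>c^p \<le> p c^p\<close>.\<close>
  proof (cases "x = 0")
    case True
    have "c powr p = c * c powr (p - 1)"
      using False assms powr_add[of c 1 "p - 1"] by simp
    moreover have "0 \<le> (p - 1) * (c * c powr (p - 1))"
      using assms by simp
    ultimately show ?thesis
      using True assms by (simp add: algebra_simps)
  next
    case x: False
    show ?thesis
    proof (rule convex_on_imp_above_tangent[of "{0<..}"])
      show "convex_on {0<..} (\<lambda>x. x powr p)"
        by (rule powr_convex[OF assms(1)])
      show "((\<lambda>x. x powr p) has_field_derivative p * c powr (p - 1)) (at c within {0<..})"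
        using False assms by (auto intro!: derivative_eq_intros)
      show "c \<in> interior {0<..}"
        using False assms(2) by (simp add: interior_open)
    qed (use x assms in auto)
  qed
  then show ?thesis by simp
qed (use assms in auto)

lemma powr_add_le:
  fixes x y p :: real
  assumes "0 \<le> x" "0 \<le> y" "0 \<le> p"
  shows "(x + y) powr p \<le> 2 powr p * (x powr p + y powr p)"
proof -
  have "(x + y) powr p \<le> (2 * max x y) powr p"
    using assms by (intro powr_mono2) auto
  also have "\<dots> = 2 powr p * max x y powr p"
    by (rule powr_mult)
  also have "\<dots> \<le> 2 powr p * (x powr p + y powr p)"
    by (intro mult_left_mono) (auto simp: max_def)
  finally show ?thesis .
qed

lemma set_integrable_const:
  "E \<in> lmeasurable \<Longrightarrow> set_integrable lebesgue E (\<lambda>x. c :: real)"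
  by (auto simp: set_integrable_def fmeasurable_def intro!: integrable_mult_left)

lemma set_integral_const:
  "E \<in> lmeasurable \<Longrightarrow> (LINT x:E|lebesgue. c) = c * measure lebesgue E" for c :: real
  by (auto simp: set_lebesgue_integral_def fmeasurable_def)

lemma set_integrable_if_bounded:
  fixes w g :: "'a::euclidean_space \<Rightarrow> real"
  assumes "w \<in> borel_measurable lebesgue" "E \<in> sets lebesgue" "set_integrable lebesgue E g"
    and "AE x in lebesgue. x \<in> E \<longrightarrow> \<bar>w x\<bar> \<le> g x"
  shows "set_integrable lebesgue E w"
  unfolding set_integrable_def
proof (rule Bochner_Integration.integrable_bound)
  show "integrable lebesgue (\<lambda>x. indicator E x *\<^sub>R g x)"
    using assms(3) by (simp add: set_integrable_def)
  show "AE x in lebesgue. norm (indicator E x *\<^sub>R w x) \<le> norm (indicator E x *\<^sub>R g x)"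
    using assms(4) by eventually_elim (auto simp: indicator_def)
  have "(\<lambda>x. indicator E x :: real) \<in> borel_measurable lebesgue"
    using assms(2) by simp
  then show "(\<lambda>x. indicator E x *\<^sub>R w x) \<in> borel_measurable lebesgue"
    using assms(1) by measurable
qed

lemma set_integral_AE_nonneg_mono_set:
  fixes f :: "'a \<Rightarrow> real"
  assumes "set_integrable M B f" "A \<in> sets M" "A \<subseteq> B" "AE x in M. x \<in> B \<longrightarrow> 0 \<le> f x"
  shows "(LINT x:A|M. f x) \<le> (LINT x:B|M. f x)"
  unfolding set_lebesgue_integral_def
proof (rule integral_mono_AE)
  show "integrable M (\<lambda>x. indicator B x *\<^sub>R f x)"
    using assms(1) by (simp add: set_integrable_def)
  show "integrable M (\<lambda>x. indicator A x *\<^sub>R f x)"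
    using set_integrable_subset[OF assms(1-3)] by (simp add: set_integrable_def)
  show "AE x in M. indicator A x *\<^sub>R f x \<le> indicator B x *\<^sub>R f x"
    using assms(4) by eventually_elim (use assms(3) in \<open>auto simp: indicator_def\<close>)
qed

text \<open>
  Jensen's inequality: integrate the tangent of the power function at the mean \<open>c\<close> of \<open>f\<close>; the
  linear term drops out.
\<close>

lemma jensen_powr_mean:
  fixes f :: "'a::euclidean_space \<Rightarrow> real"
  assumes p: "1 \<le> p" and E: "E \<in> lmeasurable" "0 < measure lebesgue E"
    and f: "set_integrable lebesgue E f" "set_integrable lebesgue E (\<lambda>x. f x powr p)"
    and f0: "\<And>x. 0 \<le> f x"
  shows "((LINT x:E|lebesgue. f x) / measure lebesgue E) powr p
      \<le> (LINT x:E|lebesgue. f x powr p) / measure lebesgue E"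
proof -
  define c where "c = (LINT x:E|lebesgue. f x) / measure lebesgue E"
  have c0: "0 \<le> c"
    unfolding c_def set_lebesgue_integral_def
    by (intro divide_nonneg_nonneg Bochner_Integration.integral_nonneg) (auto simp: f0)
  define A where "A = p * c powr (p - 1)"
  have "(LINT x:E|lebesgue. (c powr p - A * c) + A * f x) \<le> (LINT x:E|lebesgue. f x powr p)"
    using powr_ge_tangent[OF p c0 f0]
    by (intro set_integral_mono f set_integrable_const E(1) set_integral_add set_integrable_mult_right)
       (auto simp: A_def algebra_simps)
  also have "(LINT x:E|lebesgue. (c powr p - A * c) + A * f x)
      = (c powr p - A * c) * measure lebesgue E + A * (LINT x:E|lebesgue. f x)"
    by (subst set_integral_add) (auto simp: f E(1) set_integrable_const set_integral_const set_integral_mult_right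
          set_integrable_mult_right left_diff_distrib)
  also have "\<dots> = c powr p * measure lebesgue E"
    using E(2) by (simp add: c_def field_simps)
  finally show ?thesis
    using E(2) unfolding c_def[symmetric] by (simp add: field_simps)
qed

section \<open>Geometry of cubes\<close>

lemma cube_measure:
  fixes a :: "real^'n" and R :: real
  assumes "0 \<le> R"
  shows "measure lebesgue (cube a R) = R ^ CARD('n)"
  using assms content_cbox_cart[of a "\<chi> i. a $ i + R"]
  by (simp add: cube_def interval_ne_empty_cart)

lemma cube_sets [measurable]: "cube a R \<in> sets lebesgue"
  by (simp add: cube_def)

lemma cube_lmeasurable: "cube a R \<in> lmeasurable"
  by (simp add: cube_def)

lemma lmeasurable_subset_cube:
  "E \<in> sets lebesgue \<Longrightarrow> E \<subseteq> cube a R \<Longrightarrow> E \<in> lmeasurable"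
  using fmeasurableI2[OF cube_lmeasurable] by blast

text \<open>
  The crude bound by the sum of the coordinates suffices, as only dependence on the dimension counts.
\<close>

lemma norm_diff_cube_le:
  fixes x y :: "real^'n" and R :: real
  assumes "x \<in> cube a R" "y \<in> cube a R"
  shows "norm (y - x) \<le> CARD('n) * R"
proof -
  have "norm (y - x) \<le> (\<Sum>i\<in>UNIV. \<bar>(y - x) $ i\<bar>)" by (rule norm_le_l1_cart)
  also have "\<dots> \<le> (\<Sum>i\<in>(UNIV::'n set). R)"
  proof (rule sum_mono)
    fix i :: 'n
    have "a $ i \<le> x $ i \<and> x $ i \<le> a $ i + R" "a $ i \<le> y $ i \<and> y $ i \<le> a $ i + R"
      using assms by (auto simp: cube_def mem_box_cart)
    then show "\<bar>(y - x) $ i\<bar> \<le> R" by auto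
  qed
  finally show ?thesis by simp
qed

lemma cube_subset_cube:
  assumes "\<And>i. a $ i \<le> b $ i" "\<And>i. b $ i + s \<le> a $ i + R"
  shows "cube b s \<subseteq> cube a R"
proof
  fix x assume "x \<in> cube b s"
  then have "b $ i \<le> x $ i \<and> x $ i \<le> b $ i + s" for i
    by (simp add: cube_def mem_box_cart)
  then have "a $ i \<le> x $ i \<and> x $ i \<le> a $ i + R" for i
    using assms(1)[of i] assms(2)[of i] by (meson order_trans)
  then show "x \<in> cube a R"
    by (simp add: cube_def mem_box_cart)
qed

text \<open>
  \<open>S\<close> selects the coordinates in which the lower corner is moved by \<open>h\<close>. With \<open>h = R - s\<close>, the cube
  of side \<open>s\<close> based there lies in \<open>cube a R\<close> and shares with it the vertex that \<open>S\<close> encodes; for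
  \<open>s = R / 2\<close> the sets \<open>S\<close> enumerate the dyadic children.
\<close>

definition subcube_corner :: "real^'n \<Rightarrow> 'n set \<Rightarrow> real \<Rightarrow> real^'n" where
  "subcube_corner a S h = (\<chi> i. a $ i + (if i \<in> S then h else 0))"

text \<open>
  Two different children meet only inside a hyperplane that bisects the cube, a null set.
\<close>

lemma set_integral_dyadic_children:
  fixes f :: "real^'n \<Rightarrow> real" and R :: real
  assumes R: "0 < R" and f: "set_integrable lebesgue (cube a R) f"
  shows "(LINT x:cube a R|lebesgue. f x)
    = (\<Sum>S\<in>UNIV. LINT x:cube (subcube_corner a S (R / 2)) (R / 2)|lebesgue. f x)"
proof -
  let ?C = "\<lambda>S. cube (subcube_corner a S (R / 2)) (R / 2)"
  have sub: "?C S \<subseteq> cube a R" for S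
    by (rule cube_subset_cube) (use R in \<open>auto simp: subcube_corner_def\<close>)
  have cov: "cube a R \<subseteq> (\<Union>S\<in>UNIV. ?C S)"
  proof
    fix x assume "x \<in> cube a R"
    then have "a $ i \<le> x $ i \<and> x $ i \<le> a $ i + R" for i
      by (simp add: cube_def mem_box_cart)
    \<comment> \<open>\<open>x\<close> belongs to the child at the vertex formed by the coordinates where \<open>x\<close> lies in the upper half.\<close>
    then have "x \<in> ?C {i. a $ i + R / 2 < x $ i}"
      by (auto simp: cube_def mem_box_cart subcube_corner_def add.assoc)
    then show "x \<in> (\<Union>S\<in>UNIV. ?C S)" by blast
  qed
  have "(LINT x:(\<Union>S\<in>UNIV. ?C S)|lebesgue. f x) = (\<Sum>S\<in>UNIV. LINT x:?C S|lebesgue. f x)"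
  proof (rule set_integral_finite_UN_AE)
    fix S T :: "'n set"
    show "AE x in lebesgue. x \<in> ?C S \<and> x \<in> ?C T \<longrightarrow> S = T"
    proof (cases "S = T")
      case False
      then obtain i where i: "i \<in> S \<and> i \<notin> T \<or> i \<notin> S \<and> i \<in> T" by blast
      have "negligible {x :: real^'n. x $ i = a $ i + R / 2}"
        by (simp add: cart_eq_inner_axis negligible_standard_hyperplane)
      then have "AE x in lebesgue. x \<notin> {x :: real^'n. x $ i = a $ i + R / 2}"
        unfolding negligible_iff_null_sets by (rule AE_not_in)
      then show ?thesis
      proof eventually_elim
        case (elim x)
        have False if "x \<in> ?C S" "x \<in> ?C T"
          using that[unfolded cube_def mem_box_cart, THEN spec[of _ i]] i elim
          by (auto simp: subcube_corner_def)
        then show ?case by blast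
      qed
    qed simp
  qed (use set_integrable_subset[OF f _ sub] in \<open>auto simp: cube_sets\<close>)
  with cov sub show ?thesis by (metis (no_types, lifting) UN_least subset_antisym)
qed

section \<open>A Poincare inequality for pairs of points\<close>

text \<open>
  For fixed \<open>x\<close>, the map \<open>y \<mapsto> x + t (y - x)\<close> contracts the box into itself with Jacobian
  \<open>t^n \<ge> 2^{-n}\<close>, so averaging \<open>g\<close> along it costs at most the factor \<open>2^n\<close>.
\<close>

lemma integral_scaled_copy_le:
  fixes g :: "'a::euclidean_space \<Rightarrow> real"
  assumes g: "continuous_on UNIV g" "\<And>x. 0 \<le> g x"
    and t: "1 / 2 \<le> t" "t \<le> 1" and x: "x \<in> cbox a b"
  shows "integral (cbox a b) (\<lambda>y. g (x + t *\<^sub>R (y - x))) \<le> 2 ^ DIM('a) * integral (cbox a b) g"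
proof -
  define c where "c = (1 - t) *\<^sub>R x"
  define a' b' where "a' = t *\<^sub>R a + c" and "b' = t *\<^sub>R b + c"
  have gi: "g integrable_on cbox u v" for u v
    using g(1) by (intro integrable_continuous) (auto intro: continuous_on_subset)
  have sub: "cbox a' b' \<subseteq> cbox a b"
  proof -
    have "(1 - t) * (a \<bullet> i) \<le> (1 - t) * (x \<bullet> i) \<and> (1 - t) * (x \<bullet> i) \<le> (1 - t) * (b \<bullet> i)"
      if "i \<in> Basis" for i
      using x t that by (auto simp: mem_box intro!: mult_left_mono)
    then have "a \<bullet> i \<le> a' \<bullet> i \<and> b' \<bullet> i \<le> b \<bullet> i" if "i \<in> Basis" for i
      using that by (force simp: a'_def b'_def c_def inner_simps algebra_simps)
    then show ?thesis by (auto simp: subset_box)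
  qed
  have le: "integral (cbox a' b') g \<le> integral (cbox a b) g"
    by (intro integral_subset_le sub gi) (auto simp: g)
  have nn: "0 \<le> integral (cbox a' b') g"
    by (intro integral_nonneg gi) (auto simp: g)
  \<comment> \<open>\<open>cbox a' b'\<close> is the image of \<open>cbox a b\<close> under the contraction.\<close>
  have "((\<lambda>y. g (t *\<^sub>R y + c)) has_integral (integral (cbox a' b') g /\<^sub>R t ^ DIM('a)))
      (cbox ((a' - c) /\<^sub>R t) ((b' - c) /\<^sub>R t))"
    using t by (intro has_integral_affinity' integrable_integral gi) auto
  moreover have "cbox ((a' - c) /\<^sub>R t) ((b' - c) /\<^sub>R t) = cbox a b"
    using t by (simp add: a'_def b'_def)
  moreover have "t *\<^sub>R y + c = x + t *\<^sub>R (y - x)" for y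
    by (simp add: c_def algebra_simps)
  ultimately have "integral (cbox a b) (\<lambda>y. g (x + t *\<^sub>R (y - x)))
      = inverse (t ^ DIM('a)) * integral (cbox a' b') g"
    by (auto dest: integral_unique)
  also have "\<dots> \<le> 2 ^ DIM('a) * integral (cbox a b) g"
  proof (intro mult_mono le nn)
    have "inverse (t ^ DIM('a)) = inverse t ^ DIM('a)" by (simp add: power_inverse)
    also have "\<dots> \<le> 2 ^ DIM('a)"
      using t by (intro power_mono) (auto simp: field_simps)
    finally show "inverse (t ^ DIM('a)) \<le> 2 ^ DIM('a)" .
  qed auto
  finally show ?thesis .
qed

text \<open>
  The substitution of the preceding lemma degenerates as \<open>t \<rightarrow> 0\<close>. But the point at parameter \<open>t\<close>
  on the segment from \<open>x\<close> to \<open>y\<close> is the point at parameter \<open>1 - t\<close> from \<open>y\<close> to \<open>x\<close>, so exchanging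
  the two variables reduces to \<open>t \<ge> 1 / 2\<close> and the bound is uniform in \<open>t\<close>.
\<close>

lemma double_integral_segment_le:
  fixes g :: "'a::euclidean_space \<Rightarrow> real"
  assumes g: "continuous_on UNIV g" "\<And>x. 0 \<le> g x" and t: "0 \<le> t" "t \<le> 1"
  shows "integral (cbox a b) (\<lambda>x. integral (cbox a b) (\<lambda>y. g (x + t *\<^sub>R (y - x))))
      \<le> 2 ^ DIM('a) * measure lebesgue (cbox a b) * integral (cbox a b) g"
proof -
  have late: "integral (cbox a b) (\<lambda>x. integral (cbox a b) (\<lambda>y. g (x + s *\<^sub>R (y - x))))
      \<le> 2 ^ DIM('a) * measure lebesgue (cbox a b) * integral (cbox a b) g"
    if s: "1 / 2 \<le> s" "s \<le> 1" for s
  proof -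
    have "integral (cbox a b) (\<lambda>x. integral (cbox a b) (\<lambda>y. g (x + s *\<^sub>R (y - x))))
        \<le> integral (cbox a b) (\<lambda>x. 2 ^ DIM('a) * integral (cbox a b) g)"
      by (intro integral_le integrable_continuous integral_continuous_on_param
            integral_scaled_copy_le g s)
         (auto simp: split_beta intro!: continuous_on_compose2[OF g(1)] continuous_intros)
    then show ?thesis by (simp add: mult_ac)
  qed
  show ?thesis
  proof (cases "1 / 2 \<le> t")
    case True
    then show ?thesis using late t by simp
  next
    case False
    have "integral (cbox a b) (\<lambda>x. integral (cbox a b) (\<lambda>y. g (x + t *\<^sub>R (y - x))))
        = integral (cbox a b) (\<lambda>y. integral (cbox a b) (\<lambda>x. g (x + t *\<^sub>R (y - x))))"
      by (intro integral_swap_continuous)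
         (auto simp: split_beta intro!: continuous_on_compose2[OF g(1)] continuous_intros)
    also have "\<dots> = integral (cbox a b) (\<lambda>y. integral (cbox a b) (\<lambda>x. g (y + (1 - t) *\<^sub>R (x - y))))"
      by (simp add: algebra_simps)
    also have "\<dots> \<le> 2 ^ DIM('a) * measure lebesgue (cbox a b) * integral (cbox a b) g"
      using False t by (intro late) auto
    finally show ?thesis .
  qed
qed

lemma C1_continuous_on: "u \<in> C1 \<Longrightarrow> continuous_on S u"
  unfolding C1_def
  by (auto intro!: continuous_at_imp_continuous_on differentiable_imp_continuous_within)

lemma C1_continuous_on_grad: "u \<in> C1 \<Longrightarrow> continuous_on S (grad u)"
  unfolding C1_def by (auto intro: continuous_on_subset)

text \<open>
  Expand the derivative in coordinates and apply Cauchy-Schwarz.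
\<close>

lemma norm_frechet_derivative_le_grad:
  fixes u :: "real^'n \<Rightarrow> complex"
  assumes "u differentiable (at z)"
  shows "norm (frechet_derivative u (at z) h) \<le> norm h * norm (grad u z)"
proof -
  interpret linear "frechet_derivative u (at z)"
    using assms by (rule linear_frechet_derivative)
  have "h = (\<Sum>i\<in>UNIV. h $ i *\<^sub>R axis i 1)"
    using basis_expansion[of h] by (simp add: scalar_mult_eq_scaleR)
  then have "frechet_derivative u (at z) h = (\<Sum>i\<in>UNIV. h $ i *\<^sub>R grad u z $ i)"
    unfolding grad_def by (metis (mono_tags, lifting) scale sum sum.cong vec_lambda_beta)
  also have "norm \<dots> \<le> (\<Sum>i\<in>UNIV. \<bar>h $ i\<bar> * \<bar>norm (grad u z $ i)\<bar>)"
    by (rule sum_norm_le) simp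
  also have "\<dots> \<le> norm h * norm (grad u z)"
    using L2_set_mult_ineq[of "\<lambda>i. h $ i" "\<lambda>i. norm (grad u z $ i)" UNIV]
    by (simp add: norm_vec_def L2_set_def)
  finally show ?thesis .
qed

lemma norm_diff_le_segment_integral:
  fixes u :: "real^'n \<Rightarrow> complex"
  assumes "u \<in> C1"
  shows "norm (u y - u x) \<le> norm (y - x) * integral {0..1} (\<lambda>t. norm (grad u (x + t *\<^sub>R (y - x))))"
proof -
  let ?D = "\<lambda>t. frechet_derivative u (at (x + t *\<^sub>R (y - x))) (y - x)"
  have du: "u differentiable (at z)" for z
    using assms by (simp add: C1_def)
  have hi: "(?D has_integral (u (x + 1 *\<^sub>R (y - x)) - u (x + 0 *\<^sub>R (y - x)))) {0..1}"
  proof (rule fundamental_theorem_of_calculus)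
    fix t :: real
    have "((\<lambda>t. u (x + t *\<^sub>R (y - x))) has_derivative
        (\<lambda>s. frechet_derivative u (at (x + t *\<^sub>R (y - x))) (s *\<^sub>R (y - x)))) (at t within {0..1})"
      by (rule has_derivative_compose[of "\<lambda>t. x + t *\<^sub>R (y - x)" "\<lambda>s. s *\<^sub>R (y - x)" _ _ u])
         (use du frechet_derivative_works in \<open>auto intro!: derivative_eq_intros\<close>)
    then show "((\<lambda>t. u (x + t *\<^sub>R (y - x))) has_vector_derivative ?D t) (at t within {0..1})"
      using linear_scale[OF linear_frechet_derivative[OF du]]
      by (simp add: has_vector_derivative_def)
  qed simp
  have "norm (integral {0..1} ?D)
      \<le> integral {0..1} (\<lambda>t. norm (y - x) * norm (grad u (x + t *\<^sub>R (y - x))))"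
    by (intro integral_norm_bound_integral norm_frechet_derivative_le_grad du
          has_integral_integrable[OF hi] integrable_continuous_interval)
       (auto intro!: continuous_intros continuous_on_compose2[OF C1_continuous_on_grad[OF assms, of UNIV]])
  then show ?thesis
    using integral_unique[OF hi] by simp
qed

text \<open>
  Jensen's inequality on \<open>{0..1}\<close> moves the power inside the integral along the segment.
\<close>

lemma norm_diff_powr_le_segment_integral:
  fixes u :: "real^'n \<Rightarrow> complex"
  assumes u: "u \<in> C1" and p: "1 \<le> p" and D: "norm (y - x) \<le> D"
  shows "norm (u y - u x) powr p
    \<le> D powr p * integral {0..1} (\<lambda>t. norm (grad u (x + t *\<^sub>R (y - x))) powr p)"
proof -
  let ?h = "\<lambda>t. norm (grad u (x + t *\<^sub>R (y - x)))"
  have hc: "continuous_on {0..1} ?h"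
    by (intro continuous_intros continuous_on_compose2[OF C1_continuous_on_grad[OF u, of UNIV]]) auto
  have hpc: "continuous_on {0..1} (\<lambda>t. ?h t powr p)"
    using p by (intro continuous_on_powr' hc) (auto intro!: continuous_intros)
  note ai = absolutely_integrable_continuous_real[OF hc] absolutely_integrable_continuous_real[OF hpc]
  have "integral {0..1} ?h powr p \<le> integral {0..1} (\<lambda>t. ?h t powr p)"
    using jensen_powr_mean[OF p, of "{0..1}" ?h] ai
    by (simp add: set_lebesgue_integral_eq_integral(2))
  moreover have "norm (u y - u x) powr p \<le> (D * integral {0..1} ?h) powr p"
    using p norm_diff_le_segment_integral[OF u, of y x] D
    by (intro powr_mono2 order_trans[OF norm_diff_le_segment_integral[OF u]] mult_right_mono
          integral_nonneg integrable_continuous_interval hc) auto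
  moreover have "(D * integral {0..1} ?h) powr p = D powr p * integral {0..1} ?h powr p"
    by (rule powr_mult)
  ultimately show ?thesis
    by (smt (verit) mult_left_mono powr_ge_zero)
qed

text \<open>
  Bound the difference by the integral of the gradient along the segment, exchange the integrals so
  that the parameter \<open>t\<close> is outermost, and use the bound that is uniform in \<open>t\<close>. In this form no
  mean value of \<open>u\<close> occurs, which is what permits the comparison with \<open>u(x)\<close> for \<open>x\<close> in a prescribed
  subset of the cube.
\<close>

lemma poincare_double_integral:
  fixes u :: "real^'n \<Rightarrow> complex" and R :: real
  assumes u: "u \<in> C1" and p: "1 \<le> p" and R: "0 < R"
  shows "integral (cube a R) (\<lambda>x. integral (cube a R) (\<lambda>y. norm (u y - u x) powr p))
    \<le> (CARD('n) * R) powr p * (2 ^ CARD('n) * R ^ CARD('n))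
        * integral (cube a R) (\<lambda>z. norm (grad u z) powr p)"
proof -
  define b where "b = (\<chi> i. a $ i + R)"
  have Q: "cube a R = cbox a b" by (simp add: cube_def b_def)
  define g where "g z = norm (grad u z) powr p" for z
  have gc: "continuous_on UNIV g"
    unfolding g_def using p
    by (intro continuous_on_powr' continuous_on_norm C1_continuous_on_grad u) auto
  have g0: "0 \<le> g z" for z by (simp add: g_def)
  define D where "D = CARD('n) * R"
  have uc: "continuous_on S (\<lambda>z. norm (u (y z) - u (x z)) powr p)"
    if "continuous_on S x" "continuous_on S y" for S :: "'b::topological_space set" and x y
    using p that
    by (intro continuous_on_powr' continuous_on_norm continuous_on_diff continuous_on_const
          continuous_on_compose2[OF C1_continuous_on[OF u, of UNIV]]) auto
  have gc': "continuous_on S (\<lambda>z. g (x z + t z *\<^sub>R (y z - x z)))"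
    if "continuous_on S x" "continuous_on S y" "continuous_on S t" for S :: "'b::topological_space set" and x y t
    by (intro continuous_on_compose2[OF gc] continuous_intros that) auto
  have yt: "continuous_on S (\<lambda>z. integral {0..1} (\<lambda>t. g (x z + t *\<^sub>R (y z - x z))))"
    if "continuous_on S x" "continuous_on S y" for S :: "'b::euclidean_space set" and x y
    unfolding box_real(2)[symmetric]
    by (intro integral_continuous_on_param)
       (auto simp: split_beta intro!: gc' continuous_on_compose2[OF that(1)] continuous_on_compose2[OF that(2)] continuous_intros)
  have "integral (cbox a b) (\<lambda>x. integral (cbox a b) (\<lambda>y. norm (u y - u x) powr p))
     \<le> integral (cbox a b) (\<lambda>x. integral (cbox a b)
          (\<lambda>y. D powr p * integral {0..1} (\<lambda>t. g (x + t *\<^sub>R (y - x)))))"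
  proof (intro integral_le integrable_continuous integral_continuous_on_param)
    fix x y assume "x \<in> cbox a b" "y \<in> cbox a b"
    then show "norm (u y - u x) powr p \<le> D powr p * integral {0..1} (\<lambda>t. g (x + t *\<^sub>R (y - x)))"
      unfolding g_def D_def
      by (intro norm_diff_powr_le_segment_integral u p norm_diff_cube_le[of _ a R]) (auto simp: Q)
  qed (auto simp: split_beta intro!: yt uc continuous_intros)
  also have "\<dots> = D powr p * integral (cbox a b) (\<lambda>x. integral (cbox a b)
          (\<lambda>y. integral {0..1} (\<lambda>t. g (x + t *\<^sub>R (y - x)))))"
    by simp
  also have "(\<lambda>x. integral (cbox a b) (\<lambda>y. integral {0..1} (\<lambda>t. g (x + t *\<^sub>R (y - x)))))
      = (\<lambda>x. integral {0..1} (\<lambda>t. integral (cbox a b) (\<lambda>y. g (x + t *\<^sub>R (y - x)))))"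
    unfolding box_real(2)[symmetric]
    by (intro ext integral_swap_continuous) (auto simp: split_beta intro!: gc' continuous_intros)
  also have "integral (cbox a b) \<dots>
      = integral {0..1} (\<lambda>t. integral (cbox a b) (\<lambda>x. integral (cbox a b) (\<lambda>y. g (x + t *\<^sub>R (y - x)))))"
    unfolding box_real(2)[symmetric]
    by (intro integral_swap_continuous, unfold split_beta, intro integral_continuous_on_param)
       (auto simp: split_beta intro!: gc' continuous_intros)
  also have "\<dots> \<le> integral {0..1::real} (\<lambda>t. 2 ^ CARD('n) * R ^ CARD('n) * integral (cbox a b) g)"
  proof (rule integral_le)
    show "(\<lambda>t. integral (cbox a b) (\<lambda>x. integral (cbox a b) (\<lambda>y. g (x + t *\<^sub>R (y - x))))) integrable_on {0..1}"
      by (intro integrable_continuous_interval integral_continuous_on_param, unfold split_beta,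
          intro integral_continuous_on_param)
         (auto simp: split_beta intro!: gc' continuous_intros)
    show "integral (cbox a b) (\<lambda>x. integral (cbox a b) (\<lambda>y. g (x + t *\<^sub>R (y - x))))
        \<le> 2 ^ CARD('n) * R ^ CARD('n) * integral (cbox a b) g" if "t \<in> {0..1}" for t
      using double_integral_segment_le[OF gc g0, of t a b] that cube_measure[of R a] R
      by (simp add: Q)
  qed auto
  finally have "integral (cbox a b) (\<lambda>x. integral (cbox a b) (\<lambda>y. norm (u y - u x) powr p))
      \<le> D powr p * integral {0..1::real} (\<lambda>t. 2 ^ CARD('n) * R ^ CARD('n) * integral (cbox a b) g)"
    by (simp add: mult_left_mono)
  then show ?thesis
    by (simp add: Q D_def g_def[abs_def] mult_ac)
qed

section \<open>The weight: small sets carry little mass\<close>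

text \<open>
  A quantitative form of the Coifman-Fefferman characterisation of \<open>A_\<infinity>\<close>: among subsets of a cube,
  small Lebesgue measure forces small weight. The fraction 1/2 could be any number below 3/4, since
  \<open>A_infty_cond_large_set\<close> combines it with a quarter of the weight.
\<close>

definition A_infty_cond :: "real \<Rightarrow> (real^'n \<Rightarrow> real) \<Rightarrow> bool" where
  "A_infty_cond \<eta> w \<longleftrightarrow> w \<in> borel_measurable lebesgue \<and> (AE x in lebesgue. 0 < w x) \<and>
    (\<forall>a R. 0 < R \<longrightarrow> set_integrable lebesgue (cube a R) w \<and>
      (\<forall>E\<in>sets lebesgue. E \<subseteq> cube a R \<longrightarrow> measure lebesgue E \<le> \<eta> * R ^ CARD('n) \<longrightarrow>
        (LINT x:E|lebesgue. w x) \<le> (LINT x:cube a R|lebesgue. w x) / 2))"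

lemma cube_integral_pos:
  fixes w :: "real^'n \<Rightarrow> real" and R :: real
  assumes "A_infty_cond \<eta> w" "0 < R"
  shows "0 < (LINT x:cube a R|lebesgue. w x)"
proof -
  have int: "set_integrable lebesgue (cube a R) w" and pos: "AE x in lebesgue. 0 < w x"
    using assms by (auto simp: A_infty_cond_def)
  have nn: "AE x in lebesgue. x \<in> cube a R \<longrightarrow> 0 \<le> w x"
    using pos by eventually_elim simp
  have "(LINT x:cube a R|lebesgue. w x) \<ge> 0"
    using set_integral_AE_nonneg_mono_set[OF int, of "{}"] nn
    by (simp add: set_lebesgue_integral_def)
  moreover have "(LINT x:cube a R|lebesgue. w x) \<noteq> 0"
  proof
    assume "(LINT x:cube a R|lebesgue. w x) = 0"
    then have "AE x in lebesgue. indicator (cube a R) x *\<^sub>R w x = 0"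
      unfolding set_lebesgue_integral_def
      by (subst (asm) integral_nonneg_eq_0_iff_AE)
         (use int nn in \<open>auto simp: set_integrable_def indicator_def elim: eventually_mono\<close>)
    with pos have "AE x in lebesgue. x \<notin> cube a R"
      by eventually_elim (auto simp: indicator_def split: if_splits)
    then have "measure lebesgue (cube a R) = 0"
      using AE_iff_null_sets[of "cube a R" lebesgue] by (simp add: cube_sets measure_eq_0_null_sets)
    then show False using assms(2) by (simp add: cube_measure)
  qed
  ultimately show ?thesis by simp
qed

text \<open>
  Jensen's inequality on \<open>E\<close> bounds the mean of \<open>w\<close> over \<open>E\<close> by its \<open>r\<close>-mean over \<open>E\<close>. Enlarging
  the domain of the integral of \<open>w^r\<close> from \<open>E\<close> to the cube and using the reverse Hoelder inequality
  there loses the factor \<open>(|Q| / |E|)^{1 / r}\<close>, which the factor \<open>|E| / |Q|\<close> from passing between means and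
  integrals outweighs because \<open>r > 1\<close>.
\<close>

lemma B_with_const_finite_small_set:
  fixes w :: "real^'n \<Rightarrow> real" and r R :: real
  assumes w: "w \<in> B_with_const (ereal r) K" and r: "1 < r" and R: "0 < R"
    and E: "E \<in> sets lebesgue" "E \<subseteq> cube a R"
  shows "set_integrable lebesgue (cube a R) w"
    and "(LINT x:E|lebesgue. w x)
      \<le> K * (measure lebesgue E / R ^ CARD('n)) powr (1 - 1 / r) * (LINT x:cube a R|lebesgue. w x)"
proof -
  let ?Q = "cube a R"
  define N where "N = R ^ CARD('n)"
  have N: "0 < N" "measure lebesgue ?Q = N" using R by (simp_all add: N_def cube_measure)
  have meas: "w \<in> borel_measurable lebesgue" and pos: "AE x in lebesgue. 0 < w x"
    and pw: "set_integrable lebesgue ?Q (\<lambda>x. \<bar>w x\<bar> powr r)"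
    and rev: "av ?Q (\<lambda>x. w x powr r) powr (1 / r) \<le> K * av ?Q w"
    using w R by (auto simp: B_with_const_def L_loc_def cube_def)
  have Qm: "?Q \<in> lmeasurable" by (rule cube_lmeasurable)
  show int: "set_integrable lebesgue ?Q w"
  proof (rule set_integrable_if_bounded[OF meas cube_sets])
    show "set_integrable lebesgue ?Q (\<lambda>x. 1 + \<bar>w x\<bar> powr r)"
      by (intro set_integral_add set_integrable_const Qm pw)
    have "\<bar>w x\<bar> \<le> 1 + \<bar>w x\<bar> powr r" for x
    proof (cases "\<bar>w x\<bar> \<le> 1")
      case True
      then show ?thesis using powr_ge_zero[of "\<bar>w x\<bar>" r] by linarith
    next
      case False
      then have "\<bar>w x\<bar> powr 1 \<le> \<bar>w x\<bar> powr r" using r by (intro powr_mono) auto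
      then show ?thesis using False by simp
    qed
    then show "AE x in lebesgue. x \<in> ?Q \<longrightarrow> \<bar>w x\<bar> \<le> 1 + \<bar>w x\<bar> powr r" by simp
  qed
  define e where "e = measure lebesgue E"
  have Em: "E \<in> lmeasurable" using E by (rule lmeasurable_subset_cube)
  show "(LINT x:E|lebesgue. w x) \<le> K * (measure lebesgue E / R ^ CARD('n)) powr (1 - 1 / r)
      * (LINT x:?Q|lebesgue. w x)"
  proof (cases "e = 0")
    \<comment> \<open>The mean over \<open>E\<close> is not defined here, so this case is settled directly.\<close>
    case True
    then have "E \<in> null_sets lebesgue"
      using Em e_def by (simp add: negligible_iff_measure flip: negligible_iff_null_sets)
    then have "AE x in lebesgue. indicator E x *\<^sub>R w x = 0"
      by (rule AE_I') (auto simp: indicator_def)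
    then have "(LINT x:E|lebesgue. w x) = 0"
      unfolding set_lebesgue_integral_def by (rule integral_eq_zero_AE)
    then show ?thesis using True by (simp add: e_def)
  next
    case False
    then have e: "0 < e" by (simp add: e_def zero_less_measure_iff)
    define I where "I = (LINT x:?Q|lebesgue. \<bar>w x\<bar> powr r)"
    have Ieq: "(LINT x:?Q|lebesgue. w x powr r) = I"
      unfolding I_def set_lebesgue_integral_def
      by (rule integral_cong_AE, use meas in measurable) (use pos in \<open>auto elim: eventually_mono\<close>)
    have I0: "0 \<le> I"
      unfolding I_def set_lebesgue_integral_def by (rule Bochner_Integration.integral_nonneg) auto
    have "set_integrable lebesgue E (\<lambda>x. \<bar>w x\<bar>)"
      using set_integrable_abs[OF set_integrable_subset[OF int E]] .
    then have J: "((LINT x:E|lebesgue. \<bar>w x\<bar>) / e) powr r \<le> (LINT x:E|lebesgue. \<bar>w x\<bar> powr r) / e"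
      using r e unfolding e_def
      by (intro jensen_powr_mean Em set_integrable_subset[OF pw E]) auto
    have "(LINT x:E|lebesgue. \<bar>w x\<bar> powr r) \<le> I"
      unfolding I_def by (intro set_integral_AE_nonneg_mono_set pw E) auto
    then have "((LINT x:E|lebesgue. \<bar>w x\<bar>) / e) powr r \<le> I / e"
      using J e by (meson divide_right_mono less_imp_le order_trans)
    then have "(((LINT x:E|lebesgue. \<bar>w x\<bar>) / e) powr r) powr (1 / r) \<le> (I / e) powr (1 / r)"
      using r by (intro powr_mono2) auto
    moreover have w0: "0 \<le> (LINT x:E|lebesgue. \<bar>w x\<bar>)"
      unfolding set_lebesgue_integral_def by (rule Bochner_Integration.integral_nonneg) auto
    ultimately have "(LINT x:E|lebesgue. \<bar>w x\<bar>) / e \<le> (I / e) powr (1 / r)"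
      using r e by (simp add: powr_powr)
    also have "I / e = (I / N) * (N / e)" using N by simp
    also have "\<dots> powr (1 / r) = (I / N) powr (1 / r) * (N / e) powr (1 / r)"
      by (rule powr_mult)
    also have "\<dots> \<le> (K * av ?Q w) * (N / e) powr (1 / r)"
      using rev by (intro mult_right_mono) (auto simp: av_def Ieq N)
    finally have "(LINT x:E|lebesgue. \<bar>w x\<bar>) \<le> e * ((K * av ?Q w) * (N / e) powr (1 / r))"
      using e by (simp add: field_simps)
    also have "\<dots> = K * (LINT x:?Q|lebesgue. w x) * ((e / N) * (N / e) powr (1 / r))"
      by (simp add: av_def N)
    also have "(N / e) powr (1 / r) = (e / N) powr (- (1 / r))"
      using e N by (simp add: powr_minus powr_divide)
    also have "(e / N) * (e / N) powr (- (1 / r)) = (e / N) powr (1 - 1 / r)"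
      using e N powr_add[of "e / N" 1 "- (1 / r)"] by simp
    finally have "(LINT x:E|lebesgue. \<bar>w x\<bar>) \<le> K * (e / N) powr (1 - 1 / r) * (LINT x:?Q|lebesgue. w x)"
      by (simp add: mult_ac)
    moreover have "(LINT x:E|lebesgue. w x) \<le> (LINT x:E|lebesgue. \<bar>w x\<bar>)"
      using set_integrable_subset[OF int E] set_integrable_abs by (intro set_integral_mono) auto
    ultimately show ?thesis by (simp add: e_def N_def)
  qed
qed

lemma B_with_const_infinity_small_set:
  fixes w :: "real^'n \<Rightarrow> real" and R :: real
  assumes w: "w \<in> B_with_const \<infinity> K" and R: "0 < R"
    and E: "E \<in> sets lebesgue" "E \<subseteq> cube a R"
  shows "set_integrable lebesgue (cube a R) w"
    and "(LINT x:E|lebesgue. w x)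
      \<le> K * (measure lebesgue E / R ^ CARD('n)) * (LINT x:cube a R|lebesgue. w x)"
proof -
  let ?Q = "cube a R"
  let ?B = "K * av ?Q w"
  have meas: "w \<in> borel_measurable lebesgue" and pos: "AE x in lebesgue. 0 < w x"
    and rev: "esssup (restrict_space lebesgue ?Q) (\<lambda>x. ereal (w x)) \<le> ereal ?B"
    using w R by (auto simp: B_with_const_def L_loc_def cube_def)
  have "AE x in restrict_space lebesgue ?Q. ereal (w x) \<le> ereal ?B"
    using esssup_AE[of "\<lambda>x. ereal (w x)"] by (rule eventually_mono) (rule order_trans[OF _ rev])
  then have le: "AE x in lebesgue. x \<in> ?Q \<longrightarrow> w x \<le> ?B"
    by (simp add: AE_restrict_space_iff)
  show int: "set_integrable lebesgue ?Q w"
    by (rule set_integrable_if_bounded[OF meas cube_sets set_integrable_const[of _ ?B]])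
       (use le pos in \<open>auto simp: cube_lmeasurable elim: eventually_elim2\<close>)
  have Em: "E \<in> lmeasurable" using E by (rule lmeasurable_subset_cube)
  have "(LINT x:E|lebesgue. w x) \<le> (LINT x:E|lebesgue. ?B)"
    using le E
    by (intro set_integral_mono_AE set_integrable_subset[OF int E] set_integrable_const Em)
       (auto elim: eventually_mono)
  also have "\<dots> = K * (measure lebesgue E / R ^ CARD('n)) * (LINT x:?Q|lebesgue. w x)"
    using R by (simp add: set_integral_const[OF Em] av_def cube_measure)
  finally show "(LINT x:E|lebesgue. w x)
      \<le> K * (measure lebesgue E / R ^ CARD('n)) * (LINT x:?Q|lebesgue. w x)" .
qed

text \<open>
  Both cases give \<open>w(E) \<le> K (|E| / |Q|)^\<theta> w(Q)\<close> with some \<open>\<theta> > 0\<close>, and \<open>\<eta>\<close> is chosen so that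
  \<open>max 1 K \<eta>^\<theta> = 1 / 2\<close>. The maximum keeps \<open>\<eta>\<close> positive and below one for an arbitrary \<open>K\<close>.
\<close>

lemma B_with_const_imp_A_infty_cond:
  fixes K :: real and q :: ereal
  assumes q: "1 < q"
  shows "\<exists>\<eta>. 0 < \<eta> \<and> \<eta> < 1 \<and> (\<forall>w :: real^'n \<Rightarrow> real. w \<in> B_with_const q K \<longrightarrow> A_infty_cond \<eta> w)"
proof -
  define \<theta> where "\<theta> = (if q = \<infinity> then 1 else 1 - 1 / real_of_ereal q)"
  have qr: "q = \<infinity> \<or> (\<exists>r. q = ereal r \<and> 1 < r)"
    using q by (cases q) auto
  then have \<theta>: "0 < \<theta>" by (auto simp: \<theta>_def)
  define L where "L = max 1 K"
  define \<eta> where "\<eta> = (1 / (2 * L)) powr (1 / \<theta>)"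
  have L: "1 \<le> L" "K \<le> L" by (auto simp: L_def)
  have \<eta>\<theta>: "\<eta> powr \<theta> = 1 / (2 * L)"
    using \<theta> L by (simp add: \<eta>_def powr_powr)
  have \<eta>: "0 < \<eta>" "\<eta> < 1"
    using L \<theta> powr_less_mono2[of "1 / \<theta>" "1 / (2 * L)" 1] by (auto simp: \<eta>_def)
  have "A_infty_cond \<eta> w" if w: "w \<in> B_with_const q K" for w :: "real^'n \<Rightarrow> real"
  proof -
    have pos: "AE x in lebesgue. 0 < w x" and meas: "w \<in> borel_measurable lebesgue"
      using w by (auto simp: B_with_const_def L_loc_def)
    have key: "set_integrable lebesgue (cube a R) w \<and>
       (LINT x:E|lebesgue. w x) \<le> (LINT x:cube a R|lebesgue. w x) / 2"
      if R: "0 < R" and E: "E \<in> sets lebesgue" "E \<subseteq> cube a R"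
        and small: "measure lebesgue E \<le> \<eta> * R ^ CARD('n)" for a R E
    proof -
      let ?W = "LINT x:cube a R|lebesgue. w x"
      let ?s = "measure lebesgue E / R ^ CARD('n)"
      have W: "set_integrable lebesgue (cube a R) w \<and> (LINT x:E|lebesgue. w x) \<le> K * ?s powr \<theta> * ?W"
        using qr
      proof (elim disjE exE conjE)
        assume "q = \<infinity>"
        then show ?thesis
          using B_with_const_infinity_small_set[OF _ R E, of w K] w R by (simp add: \<theta>_def)
      next
        fix r assume "q = ereal r" "1 < r"
        then show ?thesis
          using B_with_const_finite_small_set[OF _ _ R E, of w r K] w by (simp add: \<theta>_def)
      qed
      have nn: "AE x in lebesgue. x \<in> cube a R \<longrightarrow> 0 \<le> w x"
        using pos by eventually_elim simp
      have W0: "0 \<le> ?W"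
        using set_integral_AE_nonneg_mono_set[of lebesgue "cube a R" w "{}"] nn W
        by (simp add: set_lebesgue_integral_def)
      have "?s \<le> \<eta>" using small R by (simp add: field_simps)
      then have "?s powr \<theta> \<le> 1 / (2 * L)"
        unfolding \<eta>\<theta>[symmetric] using \<theta> R by (intro powr_mono2) auto
      then have "K * ?s powr \<theta> \<le> L * (1 / (2 * L))"
        using L by (intro mult_mono) auto
      also have "\<dots> = 1 / 2" using L by simp
      finally have "K * ?s powr \<theta> * ?W \<le> 1 / 2 * ?W"
        using W0 by (rule mult_right_mono)
      with W show ?thesis by simp
    qed
    show ?thesis
      unfolding A_infty_cond_def
    proof (intro conjI allI impI ballI meas pos)
      show "set_integrable lebesgue (cube a R) w" if "0 < R" for a R
        using key[OF that, of "{}"] \<eta> that by simp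
    qed (rule conjunct2[OF key])
  qed
  with \<eta> show ?thesis by blast
qed

text \<open>
  Shrinking a cube towards one of its vertices by the factor \<open>\<rho>\<close> removes at most the proportion \<open>\<eta>\<close> of its
  volume, because \<open>\<rho>^n \<ge> 1 - \<eta>\<close> by Bernoulli's inequality; hence each step keeps at least half of
  the weight.
\<close>

lemma A_infty_cond_shrink_corner:
  fixes w :: "real^'n \<Rightarrow> real" and R :: real
  assumes w: "A_infty_cond \<eta> w" and \<eta>: "0 < \<eta>" "\<eta> < 1" and R: "0 < R"
  defines "\<rho> \<equiv> 1 - \<eta> / CARD('n)"
  shows "(LINT x:cube a R|lebesgue. w x) / 2 ^ k
    \<le> (LINT x:cube (subcube_corner a S (R - \<rho> ^ k * R)) (\<rho> ^ k * R)|lebesgue. w x)"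
proof (induction k)
  case 0
  then show ?case by (simp add: subcube_corner_def cong: if_cong)
next
  case (Suc k)
  have "\<eta> / CARD('n) \<le> \<eta>"
    using \<eta> divide_left_mono[of 1 "real CARD('n)" \<eta>] by (simp add: Suc_leI)
  then have \<eta>n: "0 < \<eta> / CARD('n)" "\<eta> / CARD('n) < 1"
    using \<eta> by (simp, linarith)
  have l: "0 < \<rho>" "\<rho> \<le> 1"
    using \<eta>n unfolding \<rho>_def by linarith+
  define s where "s = \<rho> ^ k * R"
  have s: "0 < s" using l R by (simp add: s_def)
  let ?P = "cube (subcube_corner a S (R - s)) s"
  let ?P' = "cube (subcube_corner a S (R - \<rho> * s)) (\<rho> * s)"
  have ls: "\<rho> * s \<le> s" using l s by simp
  have sub: "?P' \<subseteq> ?P"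
    by (rule cube_subset_cube) (use ls in \<open>auto simp: subcube_corner_def\<close>)
  have "1 + real CARD('n) * (- (\<eta> / CARD('n))) \<le> (1 + - (\<eta> / CARD('n))) ^ CARD('n)"
    by (rule Bernoulli_inequality) (use \<eta>n in linarith)
  then have ln: "1 - \<eta> \<le> \<rho> ^ CARD('n)" by (simp add: \<rho>_def)
  have "measure lebesgue (?P - ?P') = measure lebesgue ?P - measure lebesgue ?P'"
    using cube_lmeasurable by (intro measurable_measure_Diff sub) auto
  also have "\<dots> = (1 - \<rho> ^ CARD('n)) * s ^ CARD('n)"
    using s l by (simp add: cube_measure power_mult_distrib algebra_simps)
  also have "\<dots> \<le> \<eta> * s ^ CARD('n)"
    using ln s by (intro mult_right_mono) auto
  finally have "(LINT x:?P - ?P'|lebesgue. w x) \<le> (LINT x:?P|lebesgue. w x) / 2"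
    using w s unfolding A_infty_cond_def by (auto simp: cube_sets)
  moreover have int: "set_integrable lebesgue ?P w"
    using w s by (auto simp: A_infty_cond_def)
  have "(LINT x:?P' \<union> (?P - ?P')|lebesgue. w x)
      = (LINT x:?P'|lebesgue. w x) + (LINT x:?P - ?P'|lebesgue. w x)"
    by (intro set_integral_Un set_integrable_subset[OF int]) (use sub in \<open>auto simp: cube_sets\<close>)
  moreover have "?P' \<union> (?P - ?P') = ?P" using sub by auto
  ultimately have "(LINT x:?P|lebesgue. w x) / 2 \<le> (LINT x:?P'|lebesgue. w x)" by simp
  with Suc show ?case by (simp add: s_def mult_ac)
qed

text \<open>
  After finitely many shrinking steps towards a vertex, a number that depends only on \<open>\<eta>\<close> and the
  dimension, the cube lies inside the dyadic child at that vertex. The bound \<open>d \<le> 1 / 2\<close> is what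
  makes the final exponent \<open>\<beta>\<close> smaller than one.
\<close>

lemma A_infty_cond_doubling:
  assumes \<eta>: "0 < \<eta>" "\<eta> < 1"
  shows "\<exists>d. 0 < d \<and> d \<le> 1 / 2 \<and> (\<forall>(w :: real^'n \<Rightarrow> real) a R S. A_infty_cond \<eta> w \<longrightarrow> 0 < R \<longrightarrow>
    d * av (cube a R) w \<le> av (cube (subcube_corner a S (R / 2)) (R / 2)) w)"
proof -
  define l where "l = 1 - \<eta> / CARD('n)"
  have "\<eta> / CARD('n) \<le> \<eta>"
    using \<eta> divide_left_mono[of 1 "real CARD('n)" \<eta>] by (simp add: Suc_leI)
  then have \<eta>n: "0 < \<eta> / CARD('n)" "\<eta> / CARD('n) < 1"
    using \<eta> by (simp, linarith)
  have l: "0 < l" "l < 1"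
    using \<eta>n unfolding l_def by linarith+
  obtain m where m: "l ^ m < 1 / 2"
    using real_arch_pow_inv[of "1 / 2" l] l by auto
  have m0: "m \<noteq> 0" using m by (cases m) auto
  define d :: real where "d = (1 / 2) ^ m"
  have d: "0 < d" "d \<le> 1 / 2"
    using m0 power_decreasing[of 1 m "1 / 2 :: real"] by (auto simp: d_def)
  have "d * av (cube a R) w \<le> av (cube (subcube_corner a S (R / 2)) (R / 2)) w"
    if w: "A_infty_cond \<eta> w" and R: "0 < R" for w :: "real^'n \<Rightarrow> real" and a R S
  proof -
    let ?C = "cube (subcube_corner a S (R / 2)) (R / 2)"
    have lm: "l ^ m * R \<le> R / 2" using m R by simp
    have W: "0 < (LINT x:cube a R|lebesgue. w x)" using cube_integral_pos[OF w R] .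
    have int: "set_integrable lebesgue ?C w" and pos: "AE x in lebesgue. 0 < w x"
      using w R by (auto simp: A_infty_cond_def)
    have "d * (LINT x:cube a R|lebesgue. w x)
        \<le> (LINT x:cube (subcube_corner a S (R - l ^ m * R)) (l ^ m * R)|lebesgue. w x)"
      using A_infty_cond_shrink_corner[OF w \<eta> R, of a m S] by (simp add: d_def l_def power_one_over)
    also have "\<dots> \<le> (LINT x:?C|lebesgue. w x)"
      using pos lm by (intro set_integral_AE_nonneg_mono_set int cube_sets cube_subset_cube)
        (auto simp: subcube_corner_def elim: eventually_mono)
    finally have le: "d * (LINT x:cube a R|lebesgue. w x) \<le> (LINT x:?C|lebesgue. w x)" .
    have "d * av (cube a R) w = d * (LINT x:cube a R|lebesgue. w x) / R ^ CARD('n)"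
      using R by (simp add: av_def cube_measure)
    also have "\<dots> \<le> (LINT x:?C|lebesgue. w x) / (R / 2) ^ CARD('n)"
      using le R d W by (intro frac_le power_mono) (auto intro: order_trans[OF _ le])
    also have "\<dots> = av ?C w" using R by (simp add: av_def cube_measure)
    finally show ?thesis .
  qed
  with d show ?thesis by blast
qed

section \<open>The inequality at one scale and at smaller dyadic scales\<close>

lemma C1_powr_set_integrable:
  fixes u :: "real^'n \<Rightarrow> complex"
  assumes "u \<in> C1" "1 \<le> p"
  shows "set_integrable lebesgue (cube a R) (\<lambda>x. norm (u x) powr p)"
    and "set_integrable lebesgue (cube a R) (\<lambda>x. norm (grad u x) powr p)"
proof -
  show "set_integrable lebesgue (cube a R) (\<lambda>x. norm (u x) powr p)"
    using assms unfolding cube_def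
    by (intro absolutely_integrable_continuous continuous_on_powr' continuous_on_norm
          continuous_on_const C1_continuous_on) auto
  show "set_integrable lebesgue (cube a R) (\<lambda>x. norm (grad u x) powr p)"
    using assms unfolding cube_def
    by (intro absolutely_integrable_continuous continuous_on_powr' continuous_on_norm
          continuous_on_const C1_continuous_on_grad) auto
qed

lemma weight_times_C1_powr_set_integrable:
  fixes u :: "real^'n \<Rightarrow> complex" and R :: real
  assumes "u \<in> C1" "1 \<le> p" "A_infty_cond \<eta> w" "0 < R"
  shows "set_integrable lebesgue (cube a R) (\<lambda>x. w x * norm (u x) powr p)"
proof -
  have c: "continuous_on (cube a R) (\<lambda>x. norm (u x) powr p)"
    using assms by (intro continuous_on_powr' continuous_on_norm continuous_on_const
          C1_continuous_on) auto
  have "(\<lambda>x. norm (u x) powr p * w x) absolutely_integrable_on cube a R"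
  proof (rule absolutely_integrable_bounded_measurable_product[OF bilinear_times])
    show "(\<lambda>x. norm (u x) powr p) \<in> borel_measurable (lebesgue_on (cube a R))"
      using c by (rule continuous_imp_measurable_on_sets_lebesgue) (rule cube_sets)
    show "bounded ((\<lambda>x. norm (u x) powr p) ` cube a R)"
      using c by (intro compact_imp_bounded compact_continuous_image) (auto simp: cube_def)
  qed (use assms in \<open>auto simp: A_infty_cond_def cube_sets\<close>)
  then show ?thesis by (simp add: mult.commute)
qed

text \<open>
  Otherwise the set where \<open>w\<close> exceeds a quarter of its mean would carry at most half of the weight, and
  its complement carries at most a quarter.
\<close>

lemma A_infty_cond_large_set:
  fixes w :: "real^'n \<Rightarrow> real" and a :: "real^'n" and R :: real
  assumes w: "A_infty_cond \<eta> w" and R: "0 < R"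
  defines "G \<equiv> {x \<in> cube a R. av (cube a R) w / 4 < w x}"
  shows "G \<in> sets lebesgue" "\<eta> * R ^ CARD('n) \<le> measure lebesgue G"
proof -
  let ?Q = "cube a R"
  let ?W = "LINT x:?Q|lebesgue. w x"
  have W: "0 < ?W" by (rule cube_integral_pos[OF w R])
  have int: "set_integrable lebesgue ?Q w" and meas: "w \<in> borel_measurable lebesgue"
    using w R by (auto simp: A_infty_cond_def)
  have "\<forall>c. {x. c < w x} \<in> sets lebesgue"
    using meas by (simp add: borel_measurable_iff_greater)
  then have "{x. av ?Q w / 4 < w x} \<in> sets lebesgue" by (rule spec)
  then have "?Q \<inter> {x. av ?Q w / 4 < w x} \<in> sets lebesgue"
    using cube_sets by (rule sets.Int[rotated])
  moreover have "G = ?Q \<inter> {x. av ?Q w / 4 < w x}" by (auto simp: G_def)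
  ultimately show G: "G \<in> sets lebesgue" by simp
  have GQ: "G \<subseteq> ?Q" by (auto simp: G_def)
  have D: "?Q - G \<in> sets lebesgue" "?Q - G \<in> lmeasurable"
    using G lmeasurable_subset_cube[of "?Q - G" a R] by (auto simp: cube_sets)
  show "\<eta> * R ^ CARD('n) \<le> measure lebesgue G"
  proof (rule ccontr)
    assume "\<not> ?thesis"
    then have "(LINT x:G|lebesgue. w x) \<le> ?W / 2"
      using w R G GQ by (auto simp: A_infty_cond_def)
    moreover have "(LINT x:?Q - G|lebesgue. w x) \<le> (LINT x:?Q - G|lebesgue. av ?Q w / 4)"
      using D by (intro set_integral_mono set_integrable_const set_integrable_subset[OF int])
        (auto simp: G_def)
    moreover have "(LINT x:?Q - G|lebesgue. av ?Q w / 4) = av ?Q w / 4 * measure lebesgue (?Q - G)"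
      by (rule set_integral_const[OF D(2)])
    moreover have "\<dots> \<le> av ?Q w / 4 * measure lebesgue ?Q"
      using W D by (intro mult_left_mono measure_mono_fmeasurable cube_lmeasurable)
        (auto simp: av_def)
    moreover have "\<dots> = ?W / 4"
      using R by (simp add: av_def cube_measure)
    moreover have "(LINT x:G \<union> (?Q - G)|lebesgue. w x)
        = (LINT x:G|lebesgue. w x) + (LINT x:?Q - G|lebesgue. w x)"
      using G D GQ by (intro set_integral_Un set_integrable_subset[OF int]) auto
    moreover have "G \<union> (?Q - G) = ?Q" using GQ by auto
    ultimately show False using W by simp
  qed
qed

text \<open>
  With \<open>c = min(R^{-p}, m / 4)\<close>, multiply the inequality
  \<open>|u(y)|^p \<le> 2^p (|u(y) - u(x)|^p + |u(x)|^p)\<close> by \<open>c\<close> and integrate over \<open>y\<close> in the cube and \<open>x\<close> in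
  the set \<open>G\<close> where \<open>w > m / 4\<close>. In the first term \<open>c \<le> R^{-p}\<close> matches the scaling of the Poincare
  inequality; in the second \<open>c \<le> w(x)\<close>; and \<open>G\<close> has measure at least \<open>\<eta> R^n\<close>.
\<close>

lemma fefferman_phong_one_scale:
  fixes u :: "real^'n \<Rightarrow> complex" and R p :: real
  assumes u: "u \<in> C1" and p: "1 \<le> p" and w: "A_infty_cond \<eta> w" and \<eta>: "0 < \<eta>" and R: "0 < R"
  shows "\<eta> / (4 * 2 powr p * (real CARD('n) powr p * 2 ^ CARD('n)))
      * min (R powr (- p)) (av (cube a R) w) * (LINT x:cube a R|lebesgue. norm (u x) powr p)
    \<le> (LINT x:cube a R|lebesgue. norm (grad u x) powr p + w x * norm (u x) powr p)"
proof -
  let ?Q = "cube a R"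
  define N where "N = R ^ CARD('n)"
  \<comment> \<open>The Poincare constant after scaling out \<open>R\<close>.\<close>
  define M where "M = real CARD('n) powr p * 2 ^ CARD('n)"
  define m where "m = av ?Q w"
  define c where "c = min (R powr (- p)) (m / 4)"
  define G where "G = {x \<in> ?Q. m / 4 < w x}"
  define H where "H x = integral ?Q (\<lambda>y. norm (u y - u x) powr p)" for x
  define U where "U = (LINT x:?Q|lebesgue. norm (u x) powr p)"
  define Gr where "Gr = (LINT x:?Q|lebesgue. norm (grad u x) powr p)"
  define V where "V = (LINT x:?Q|lebesgue. w x * norm (u x) powr p)"
  have N: "0 < N" "measure lebesgue ?Q = N" using R by (simp_all add: N_def cube_measure)
  have M: "1 \<le> M"
  proof -
    have "1 \<le> real CARD('n) powr p"
      using p by (intro ge_one_powr_ge_zero) (simp_all add: Suc_leI)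
    moreover have "1 \<le> (2 :: real) ^ CARD('n)" by simp
    ultimately show ?thesis
      unfolding M_def using mult_mono[of 1 "real CARD('n) powr p" 1 "2 ^ CARD('n)"] by simp
  qed
  have G: "G \<in> sets lebesgue" "\<eta> * N \<le> measure lebesgue G" and GQ: "G \<subseteq> ?Q"
    using A_infty_cond_large_set[OF w R, of a] by (auto simp: G_def N_def m_def)
  have m0: "0 < m"
    using cube_integral_pos[OF w R, of a] N by (simp add: m_def av_def)
  have pos: "AE x in lebesgue. 0 < w x" using w by (simp add: A_infty_cond_def)
  have c0: "0 < c" using m0 R by (simp add: c_def)
  note iu = C1_powr_set_integrable[OF u p, of a R]
  note iw = weight_times_C1_powr_set_integrable[OF u p w R, of a]
  have U0: "0 \<le> U" and Gr0: "0 \<le> Gr"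
    unfolding U_def Gr_def set_lebesgue_integral_def
    by (auto intro!: Bochner_Integration.integral_nonneg)
  have V0: "0 \<le> V"
    unfolding V_def set_lebesgue_integral_def
    by (rule integral_nonneg_AE) (use pos in \<open>eventually_elim, simp\<close>)
  have cont: "continuous_on (S \<times> T) (\<lambda>(x, y). norm (u y - u x) powr p)" for S T
    unfolding split_beta using p
    by (intro continuous_on_powr' continuous_on_norm continuous_on_diff continuous_on_const
          continuous_on_compose2[OF C1_continuous_on[OF u, of UNIV]] continuous_on_fst continuous_on_snd continuous_on_id) auto
  have Hc: "continuous_on ?Q H"
    unfolding H_def cube_def by (intro integral_continuous_on_param cont)
  have Hi: "set_integrable lebesgue ?Q H"
    using Hc unfolding cube_def by (rule absolutely_integrable_continuous)
  have ui: "(\<lambda>y. norm (u y - u x) powr p) integrable_on ?Q" for x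
    unfolding cube_def using p
    by (intro integrable_continuous continuous_on_powr' continuous_on_norm continuous_on_diff
          continuous_on_const C1_continuous_on u) auto
  have U_le: "U \<le> 2 powr p * (H x + N * norm (u x) powr p)" if "x \<in> ?Q" for x
  proof -
    have ci: "(\<lambda>y. norm (u x) powr p) integrable_on ?Q"
      unfolding cube_def by (rule integrable_const)
    have "U = integral ?Q (\<lambda>y. norm (u y) powr p)"
      unfolding U_def by (rule set_lebesgue_integral_eq_integral(2)[OF iu(1)])
    also have "\<dots> \<le> integral ?Q (\<lambda>y. 2 powr p * (norm (u y - u x) powr p + norm (u x) powr p))"
    proof (rule integral_le)
      show "norm (u y) powr p \<le> 2 powr p * (norm (u y - u x) powr p + norm (u x) powr p)" for y
        using p norm_triangle_ineq[of "u y - u x" "u x"]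
        by (intro order_trans[OF powr_mono2 powr_add_le]) auto
    qed (intro set_lebesgue_integral_eq_integral(1)[OF iu(1)] integrable_on_mult_right
          integrable_add ui ci)+
    also have "\<dots> = 2 powr p * (H x + N * norm (u x) powr p)"
      using N ui ci by (simp add: integral_add H_def) (simp add: cube_def)
    finally show ?thesis .
  qed
  have "measure lebesgue G * (c * U) = (LINT x:?Q|lebesgue. indicator G x * (c * U))"
  proof -
    have "indicator ?Q x *\<^sub>R (indicator G x * (c * U)) = indicator G x *\<^sub>R (c * U)" for x
      using GQ by (auto simp: indicator_def)
    then have "(LINT x:?Q|lebesgue. indicator G x * (c * U)) = (LINT x:G|lebesgue. c * U)"
      by (simp only: set_lebesgue_integral_def)
    then show ?thesis
      unfolding set_integral_const[OF lmeasurable_subset_cube[OF G(1) GQ]]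
      by (simp only: mult.commute)
  qed
  also have "\<dots> \<le> (LINT x:?Q|lebesgue. 2 powr p * (R powr (- p) * H x + N * (w x * norm (u x) powr p)))"
  proof (rule set_integral_mono_AE)
    have "set_integrable lebesgue G (\<lambda>x. c * U)"
      by (rule set_integrable_const[OF lmeasurable_subset_cube[OF G(1) GQ]])
    moreover have "indicator ?Q x *\<^sub>R (indicator G x * (c * U)) = indicator G x *\<^sub>R (c * U)" for x
      using GQ by (auto simp: indicator_def)
    ultimately show "set_integrable lebesgue ?Q (\<lambda>x. indicator G x * (c * U))"
      by (simp only: set_integrable_def)
    show "set_integrable lebesgue ?Q (\<lambda>x. 2 powr p * (R powr (- p) * H x + N * (w x * norm (u x) powr p)))"
      by (intro set_integrable_mult_right set_integral_add Hi iw)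
    show "AE x\<in>?Q in lebesgue. indicator G x * (c * U)
        \<le> 2 powr p * (R powr (- p) * H x + N * (w x * norm (u x) powr p))"
      using pos
    proof eventually_elim
      case (elim x)
      have H0: "0 \<le> H x"
        unfolding H_def by (rule integral_nonneg[OF ui]) simp
      show ?case
      proof (cases "x \<in> G")
        case False
        then show ?thesis using elim H0 N by simp
      next
        case True
        then have x: "x \<in> ?Q" "c \<le> w x" "c \<le> R powr (- p)" by (auto simp: G_def c_def)
        have "c * U \<le> c * (2 powr p * (H x + N * norm (u x) powr p))"
          using U_le[OF x(1)] c0 by (intro mult_left_mono) auto
        also have "\<dots> = 2 powr p * (c * H x + N * (c * norm (u x) powr p))"
          by (simp add: algebra_simps)
        also have "\<dots> \<le> 2 powr p * (R powr (- p) * H x + N * (w x * norm (u x) powr p))"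
          using x H0 N by (intro mult_left_mono add_mono mult_right_mono) auto
        finally show ?thesis using True by simp
      qed
    qed
  qed
  also have "\<dots> = 2 powr p * (R powr (- p) * (LINT x:?Q|lebesgue. H x) + N * V)"
    using Hi iw by (simp add: set_integral_add set_integrable_mult_right V_def)
  also have "\<dots> \<le> 2 powr p * (M * N * Gr + N * V)"
  proof -
    have "(LINT x:?Q|lebesgue. H x) = integral ?Q H"
      by (rule set_lebesgue_integral_eq_integral(2)[OF Hi])
    also have "\<dots> \<le> (CARD('n) * R) powr p * (2 ^ CARD('n) * N) * Gr"
      using poincare_double_integral[OF u p R, of a] set_lebesgue_integral_eq_integral(2)[OF iu(2)]
      by (simp add: H_def[abs_def] N_def Gr_def)
    also have "\<dots> = R powr p * (M * N * Gr)"
      by (simp add: M_def powr_mult)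
    finally have "R powr (- p) * (LINT x:?Q|lebesgue. H x) \<le> R powr (- p) * (R powr p * (M * N * Gr))"
      by (intro mult_left_mono) auto
    also have "\<dots> = M * N * Gr"
      using R by (simp add: mult.assoc[symmetric] powr_add[symmetric])
    finally show ?thesis using N by (intro mult_left_mono add_mono) auto
  qed
  also have "\<dots> \<le> 2 powr p * (M * N * Gr + M * N * V)"
    using M N V0 mult_right_mono[of 1 M "N * V"] by (intro mult_left_mono add_mono) auto
  also have "\<dots> = N * (2 powr p * M * (Gr + V))" by (simp add: algebra_simps)
  finally have "measure lebesgue G * (c * U) \<le> N * (2 powr p * M * (Gr + V))" .
  moreover have "N * (\<eta> * (c * U)) \<le> measure lebesgue G * (c * U)"
    using mult_right_mono[OF G(2), of "c * U"] c0 U0 by (simp add: mult_ac)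
  ultimately have "\<eta> * (c * U) \<le> 2 powr p * M * (Gr + V)"
    using N by (meson mult_le_cancel_left_pos order_trans)
  moreover have "\<eta> * (min (R powr (- p)) m / 4 * U) \<le> \<eta> * (c * U)"
    using \<eta> U0 m0 by (intro mult_left_mono mult_right_mono) (auto simp: c_def min_def)
  ultimately have "\<eta> * (min (R powr (- p)) m / 4 * U) \<le> 2 powr p * M * (Gr + V)" by linarith
  then have "\<eta> / (4 * 2 powr p * M) * min (R powr (- p)) m * U \<le> Gr + V"
    using M by (simp add: field_simps)
  moreover have "(LINT x:?Q|lebesgue. norm (grad u x) powr p + w x * norm (u x) powr p) = Gr + V"
    unfolding Gr_def V_def by (rule set_integral_add(2)[OF iu(2) iw])
  ultimately show ?thesis by (simp add: M_def m_def U_def)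
qed

text \<open>
  Induction on the number of halvings: the inequality for the children, whose means are at least
  \<open>d\<close> times that of the cube, adds up to the inequality for the cube.
\<close>

lemma fefferman_phong_dyadic_scale:
  fixes w :: "real^'n \<Rightarrow> real" and u :: "real^'n \<Rightarrow> complex" and C R p d :: real
  assumes u: "u \<in> C1" and p: "1 \<le> p" and w: "A_infty_cond \<eta> w" and C: "0 \<le> C" and d: "0 \<le> d"
    and doubling: "\<And>a R S. 0 < R \<Longrightarrow>
      d * av (cube a R) w \<le> av (cube (subcube_corner a S (R / 2)) (R / 2)) w"
    and base: "\<And>a R. 0 < R \<Longrightarrow>
      C * min (R powr (- p)) (av (cube a R) w) * (LINT x:cube a R|lebesgue. norm (u x) powr p)
      \<le> (LINT x:cube a R|lebesgue. norm (grad u x) powr p + w x * norm (u x) powr p)"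
    and R: "0 < R"
  shows "C * min ((R / 2 ^ k) powr (- p)) (d ^ k * av (cube a R) w)
        * (LINT x:cube a R|lebesgue. norm (u x) powr p)
      \<le> (LINT x:cube a R|lebesgue. norm (grad u x) powr p + w x * norm (u x) powr p)"
  using R
proof (induction k arbitrary: a R)
  case 0
  then show ?case using base by simp
next
  case (Suc k)
  let ?C = "\<lambda>S. cube (subcube_corner a S (R / 2)) (R / 2)"
  let ?U = "\<lambda>Q. LINT x:Q|lebesgue. norm (u x) powr p"
  let ?F = "\<lambda>Q. LINT x:Q|lebesgue. norm (grad u x) powr p + w x * norm (u x) powr p"
  let ?c = "C * min ((R / 2 ^ Suc k) powr (- p)) (d ^ Suc k * av (cube a R) w)"
  have child: "?c * ?U (?C S) \<le> ?F (?C S)" for S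
  proof -
    have "d ^ Suc k * av (cube a R) w \<le> d ^ k * av (?C S) w"
      using mult_left_mono[OF doubling[OF Suc.prems, of a S], of "d ^ k"] d by (simp add: mult_ac)
    then have "?c \<le> C * min ((R / 2 / 2 ^ k) powr (- p)) (d ^ k * av (?C S) w)"
      using C by (intro mult_left_mono min.mono) (auto simp: field_simps)
    moreover have "0 \<le> ?U (?C S)"
      unfolding set_lebesgue_integral_def by (rule Bochner_Integration.integral_nonneg) auto
    ultimately have "?c * ?U (?C S)
        \<le> C * min ((R / 2 / 2 ^ k) powr (- p)) (d ^ k * av (?C S) w) * ?U (?C S)"
      by (rule mult_right_mono)
    also have "\<dots> \<le> ?F (?C S)"
      using Suc.prems by (intro Suc.IH) auto
    finally show ?thesis .
  qed
  note iu = C1_powr_set_integrable[OF u p, of a R]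
  note iw = weight_times_C1_powr_set_integrable[OF u p w Suc.prems, of a]
  have "?c * ?U (cube a R) = (\<Sum>S\<in>UNIV. ?c * ?U (?C S))"
    unfolding set_integral_dyadic_children[OF Suc.prems iu(1)] by (rule sum_distrib_left)
  also have "\<dots> \<le> (\<Sum>S\<in>UNIV. ?F (?C S))"
    by (rule sum_mono) (rule child)
  also have "\<dots> = ?F (cube a R)"
    by (rule set_integral_dyadic_children[OF Suc.prems set_integral_add(1)[OF iu(2) iw], symmetric])
  finally show ?case .
qed

text \<open>
  Take \<open>k = 0\<close> if \<open>X \<le> 1\<close>, and otherwise the largest \<open>k\<close> with \<open>(2^p / d)^k \<le> X\<close>, for which \<open>2^{kp}\<close> is
  the smaller entry of the minimum. Rounding \<open>k\<close> down costs the factor \<open>2^p\<close>, and \<open>\<beta>\<close> is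
  defined by \<open>(2^p / d)^\<beta> = 2^p\<close>.
\<close>

lemma m_fun_le_some_scale:
  fixes p d X :: real
  assumes p: "1 \<le> p" and d: "0 < d" "d < 1" and X: "0 < X"
  defines "\<beta> \<equiv> log (2 powr p / d) (2 powr p)"
  shows "\<exists>k. m_fun \<beta> X \<le> 2 powr p * min ((2 ^ k) powr p) (d ^ k * X)"
proof (cases "X \<le> 1")
  case True
  have "1 \<le> 2 powr p" using p by (intro ge_one_powr_ge_zero) auto
  then have "X \<le> 2 powr p * min ((2 ^ 0) powr p) (d ^ 0 * X)"
    using True X by simp
  then show ?thesis using True by (metis m_fun_def)
next
  case False
  define B where "B = 2 powr p / d"
  have "1 \<le> 2 powr p" using p by (intro ge_one_powr_ge_zero) auto
  then have B: "1 < B" using d by (simp add: B_def)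
  define k where "k = nat \<lfloor>log B X\<rfloor>"
  have "0 \<le> log B X" using B False by simp
  then have k: "real k \<le> log B X" "log B X < real k + 1"
    by (auto simp: k_def of_nat_nat)
  have "B ^ k \<le> X"
    using k(1) B X by (simp add: le_log_iff powr_realpow)
  then have "d ^ k * B ^ k \<le> d ^ k * X"
    using d by (intro mult_left_mono) auto
  moreover have "d ^ k * B ^ k = (2 ^ k) powr p"
  proof -
    have "d ^ k * B ^ k = (2 powr p) ^ k"
      using d by (simp add: B_def flip: power_mult_distrib)
    also have "\<dots> = (2 ^ k) powr p"
      by (simp add: powr_powr mult.commute flip: powr_realpow)
    finally show ?thesis .
  qed
  ultimately have min: "min ((2 ^ k) powr p) (d ^ k * X) = (2 ^ k) powr p" by simp
  have B\<beta>: "B powr \<beta> = 2 powr p"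
    using B by (simp add: \<beta>_def B_def[symmetric])
  have \<beta>: "0 \<le> \<beta>"
    using B p unfolding \<beta>_def B_def[symmetric] by (simp add: log_def)
  have "X \<le> B powr (real k + 1)"
    using k(2) B X by (simp add: log_less_iff)
  then have "X powr \<beta> \<le> (B powr (real k + 1)) powr \<beta>"
    using X \<beta> by (intro powr_mono2) auto
  also have "\<dots> = (B powr \<beta>) powr (real k + 1)"
    by (simp add: powr_powr mult.commute)
  also have "\<dots> = 2 powr p * (2 ^ k) powr p"
    by (simp add: B\<beta> powr_powr powr_realpow[symmetric] powr_add[symmetric] algebra_simps)
  finally show ?thesis
    using False min unfolding m_fun_def by (intro exI[of _ k]) simp
qed

theorem lemma2p1:
  fixes p K :: real and q :: ereal
  assumes "1 \<le> p" and "1 < q"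
  shows "\<exists>C \<beta>. 0 < C \<and> 0 < \<beta> \<and> \<beta> < 1 \<and>
    (\<forall>w :: real^'n \<Rightarrow> real. w \<in> A_infty \<longrightarrow> w \<in> B_with_const q K \<longrightarrow>
      (\<forall>a R u. 0 < R \<longrightarrow> u \<in> C1 \<longrightarrow>
        (LINT x:cube a R|lebesgue. norm (grad u x) powr p + w x * norm (u x) powr p)
          \<ge> C * m_fun \<beta> (R powr p * av (cube a R) w) / R powr p
              * (LINT x:cube a R|lebesgue. norm (u x) powr p)))"
proof -
  obtain \<eta> where \<eta>: "0 < \<eta>" "\<eta> < 1"
    and cond: "\<And>w :: real^'n \<Rightarrow> real. w \<in> B_with_const q K \<Longrightarrow> A_infty_cond \<eta> w"
    using B_with_const_imp_A_infty_cond[OF assms(2)] by blast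
  obtain d where d: "0 < d" "d \<le> 1 / 2"
    and doubling: "\<And>(w :: real^'n \<Rightarrow> real) a R S. A_infty_cond \<eta> w \<Longrightarrow> 0 < R \<Longrightarrow>
      d * av (cube a R) w \<le> av (cube (subcube_corner a S (R / 2)) (R / 2)) w"
    using A_infty_cond_doubling[OF \<eta>] by blast
  \<comment> \<open>The solution of \<open>(2^p / d)^\<beta> = 2^p\<close>, which balances the two entries of the dyadic minimum.\<close>
  define \<beta> where "\<beta> = log (2 powr p / d) (2 powr p)"
  define C where "C = \<eta> / (4 * 2 powr p * (real CARD('n) powr p * 2 ^ CARD('n)))"
  have C: "0 < C" using \<eta> by (simp add: C_def)
  have two: "1 < 2 powr p" using assms(1) by simp
  have "2 powr p < 2 powr p / d" using d by (simp add: field_simps)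
  then have \<beta>: "0 < \<beta>" "\<beta> < 1"
    using two by (simp_all add: \<beta>_def)
  have main: "C / 2 powr p * m_fun \<beta> (R powr p * av (cube a R) w) / R powr p
        * (LINT x:cube a R|lebesgue. norm (u x) powr p)
      \<le> (LINT x:cube a R|lebesgue. norm (grad u x) powr p + w x * norm (u x) powr p)"
    if w: "A_infty_cond \<eta> w" and R: "0 < R" and u: "u \<in> C1"
    for w :: "real^'n \<Rightarrow> real" and a R u
  proof -
    define X where "X = R powr p * av (cube a R) w"
    define U where "U = (LINT x:cube a R|lebesgue. norm (u x) powr p)"
    have U0: "0 \<le> U"
      unfolding U_def set_lebesgue_integral_def by (rule Bochner_Integration.integral_nonneg) auto
    have X: "0 < X"
      using cube_integral_pos[OF w R, of a] R by (simp add: X_def av_def cube_measure)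
    obtain k where k: "m_fun \<beta> X \<le> 2 powr p * min ((2 ^ k) powr p) (d ^ k * X)"
      using m_fun_le_some_scale[OF assms(1) d(1) _ X] d(2) unfolding \<beta>_def by auto
    have "C / 2 powr p * m_fun \<beta> X / R powr p * U
        \<le> C / 2 powr p * (2 powr p * min ((2 ^ k) powr p) (d ^ k * X)) / R powr p * U"
      using k C U0 by (intro mult_right_mono divide_right_mono mult_left_mono) auto
    also have "\<dots> = C * (min ((2 ^ k) powr p) (d ^ k * X) / R powr p) * U" by simp
    also have "min ((2 ^ k) powr p) (d ^ k * X) / R powr p
        = min ((2 ^ k) powr p / R powr p) (d ^ k * X / R powr p)"
      using R by (simp add: min_divide_distrib_right)
    also have "d ^ k * X / R powr p = d ^ k * av (cube a R) w"
      using R by (simp add: X_def)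
    also have "(2 ^ k) powr p / R powr p = (R / 2 ^ k) powr (- p)"
      using R by (simp add: powr_minus_divide powr_divide)
    also have "C * min ((R / 2 ^ k) powr (- p)) (d ^ k * av (cube a R) w) * U
        \<le> (LINT x:cube a R|lebesgue. norm (grad u x) powr p + w x * norm (u x) powr p)"
      unfolding U_def
    proof (rule fefferman_phong_dyadic_scale[OF u assms(1) w _ _ doubling[OF w] _ R])
      show "C * min (R powr (- p)) (av (cube a R) w) * (LINT x:cube a R|lebesgue. norm (u x) powr p)
        \<le> (LINT x:cube a R|lebesgue. norm (grad u x) powr p + w x * norm (u x) powr p)"
        if "0 < R" for a R
        unfolding C_def by (rule fefferman_phong_one_scale[OF u assms(1) w \<eta>(1) that])
    qed (use C d in auto)
    finally show ?thesis by (simp add: X_def U_def)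
  qed
  show ?thesis
    by (rule exI[of _ "C / 2 powr p"], rule exI[of _ \<beta>]) (use C \<beta> main cond in auto)
qed

end
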